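(* There exists an absolute constant $C>0$ such that for all positive integers $m<n$, $$\mathcal{D}_n^m \le C\,\frac{n\ln(m+1)}{\ln\frac{n}{m}}\left(\ln\ln\left(\frac{n}{m}\right)^m\right)^2 .$$
   Context: Let $\mathcal{E}=\{e_1,\dots,e_n\}$ be the standard basis of $\mathbb{Z}^n$. For a lattice $\Lambda$ with $\mathbb{Z}^n\subseteq\Lambda\subset\mathbb{Q}^n$, the defect $d(\mathcal{E},\Lambda)$ is the smallest integer $d$ such that some $n-d$ vectors of $\mathcal{E}$ together with some $d$ vectors of $\Lambda$ form a basis of $\Lambda$. The unit octahedron $O^n=\{x\in\mathbb{R}^n: |x_1|+\dots+|x_n|\le 1\}$ is called admissible with respect to $\Lambda$ if $O^n\cap\Lambda=\{0,\pm e_1,\dots,\pm e_n\}$. Let $\mathcal{A}^*_m$ be the set of all lattices $\Lambda=\langle \mathbb{Z}^n,a_1,\dots,a_m\rangle_{\mathbb{Z}}$ with $a_1,\dots,a_m\in\mathbb{Q}^n$ for which there is a square-free positive integer $q$ with $qa_1,\dots,qa_m\in\mathbb{Z}^n$. Define $\mathcal{D}_n^m=\max d(\mathcal{E},\Lambda)$, the maximum over all $\Lambda\in\mathcal{A}^*_m$ with respect to which $O^n$ is admissible. $\ln$ is the natural logarithm.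
   Formalization: For m = n−1 the factor (ln ln (n/m)^m)² is replaced by 1, since the printed bound fails there: the right side is O(ln n), while lattices Z^n + ½H with H a shortened Hamming code have defect at least n − ⌈log₂(n+1)⌉. For m ≤ n−2 the bound is as printed. *)

theory Defs
  imports
    Complex_Main
    "HOL-Library.Function_Algebras"
    "HOL-Computational_Algebra.Squarefree"
begin

text \<open>
  Vectors of length \<open>n\<close> are functions \<^typ>\<open>nat \<Rightarrow> real\<close> with coordinates indexed by
  \<open>0, \<dots>, n - 1\<close> that vanish outside this range, so that all dimensions share one type, an
  abelian group under pointwise addition. Integer span and linear independence
  are those of this group regarded as a module over the integers.
\<close>

definition zscale :: "int \<Rightarrow> (nat \<Rightarrow> real) \<Rightarrow> (nat \<Rightarrow> real)" where
  "zscale k x = (\<lambda>i. of_int k * x i)"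

interpretation zmod: module zscale
  by unfold_locales (auto simp: zscale_def fun_eq_iff algebra_simps)

definition real_space :: "nat \<Rightarrow> (nat \<Rightarrow> real) set" where
  "real_space n = {x. \<forall>i\<ge>n. x i = 0}"

definition rat_space :: "nat \<Rightarrow> (nat \<Rightarrow> real) set" where
  "rat_space n = {x \<in> real_space n. \<forall>i<n. x i \<in> \<rat>}"

definition int_lattice :: "nat \<Rightarrow> (nat \<Rightarrow> real) set" where
  "int_lattice n = {x \<in> real_space n. \<forall>i<n. x i \<in> \<int>}"

definition unit_vector :: "nat \<Rightarrow> (nat \<Rightarrow> real)" where
  "unit_vector i = (\<lambda>j. if j = i then 1 else 0)"

definition std_basis :: "nat \<Rightarrow> (nat \<Rightarrow> real) set" where
  "std_basis n = unit_vector ` {..<n}"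

definition is_lattice_basis :: "(nat \<Rightarrow> real) set \<Rightarrow> (nat \<Rightarrow> real) set \<Rightarrow> bool" where
  "is_lattice_basis B \<Lambda> \<longleftrightarrow> zmod.independent B \<and> zmod.span B = \<Lambda>"

definition defect :: "nat \<Rightarrow> (nat \<Rightarrow> real) set \<Rightarrow> nat" where
  "defect n \<Lambda> = (LEAST d. d \<le> n \<and>
     (\<exists>S T. S \<subseteq> std_basis n \<and> card S = n - d \<and>
            T \<subseteq> \<Lambda> \<and> finite T \<and> card T = d \<and>
            is_lattice_basis (S \<union> T) \<Lambda>))"

definition octahedron :: "nat \<Rightarrow> (nat \<Rightarrow> real) set" where
  "octahedron n = {x \<in> real_space n. (\<Sum>i<n. \<bar>x i\<bar>) \<le> 1}"

definition admissible :: "nat \<Rightarrow> (nat \<Rightarrow> real) set \<Rightarrow> bool" where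
  "admissible n \<Lambda> \<longleftrightarrow>
     octahedron n \<inter> \<Lambda> = {0} \<union> std_basis n \<union> uminus ` std_basis n"

definition squarefree_lattices :: "nat \<Rightarrow> nat \<Rightarrow> (nat \<Rightarrow> real) set set" where
  "squarefree_lattices n m =
     {zmod.span (int_lattice n \<union> a ` {..<m}) | a :: nat \<Rightarrow> nat \<Rightarrow> real.
        (\<forall>j<m. a j \<in> rat_space n) \<and>
        (\<exists>q::nat. q > 0 \<and> squarefree q \<and> (\<forall>j<m. zscale (int q) (a j) \<in> int_lattice n))}"

definition max_defect :: "nat \<Rightarrow> nat \<Rightarrow> nat" where
  "max_defect n m = Max {defect n \<Lambda> | \<Lambda>. \<Lambda> \<in> squarefree_lattices n m \<and> admissible n \<Lambda>}"

end

(*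
  Restricting to a set I of coordinates, the defect is at most |I| as soon as no nonzero torsion
  element of Lambda / Z^n vanishes on I; it suffices to look at the p-torsion for the primes p
  dividing q.  By admissibility and the pigeonhole principle, p-torsion of rank r supported on s
  coordinates satisfies p^r <= s^s, so for p > T some lam r coordinates are needed, and averaging
  over all coordinates yields one that lowers the total rank (over all p > T) by the factor
  1 - lam / n.  Choosing t coordinates greedily, and then one coordinate for every remaining unit
  of rank, gives
    d <= t + exp (- lam t / n) n ln n / ln T + m T,
  where m T accounts for the primes up to T, and n ln n / ln T bounds the initial total rank since
  the torsion group has at most n^n elements.  One takes T = sqrt (n/m), L = m ln (n/m),
  lam = ln (n/m) / (2 ln L) and t = n ln L / lam; when ln (n/m) is at most a constant times
  ln (m + 1), the trivial bound d <= n is enough.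
*)
theory Submission
  imports Defs "HOL-Library.FuncSet"
begin

section \<open>Integer vectors, unit vectors and the sublattices they span\<close>

lemma zscale_apply: "zscale k x i = of_int k * x i"
  by (simp add: zscale_def)

lemma sum_apply_fun: "(\<Sum>v\<in>A. f v) i = (\<Sum>v\<in>A. f v (i::nat) :: real)"
  by (induction A rule: infinite_finite_induct) auto

lemma int_lattice_iff: "x \<in> int_lattice n \<longleftrightarrow> (\<forall>i. x i \<in> \<int>) \<and> (\<forall>i\<ge>n. x i = 0)"
  unfolding int_lattice_def real_space_def
  by (auto, metis Ints_0 linorder_not_less)

lemma subspace_int_lattice: "zmod.subspace (int_lattice n)"
  by (rule zmod.subspaceI) (auto simp: int_lattice_iff zscale_apply)

lemma subspace_real_space: "zmod.subspace (real_space n)"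
  by (rule zmod.subspaceI) (auto simp: real_space_def zscale_apply)

lemma unit_vector_apply: "unit_vector i j = (if j = i then 1 else 0)"
  by (simp add: unit_vector_def)

lemma unit_vector_in_int_lattice: "i < n \<Longrightarrow> unit_vector i \<in> int_lattice n"
  by (auto simp: int_lattice_iff unit_vector_apply)

lemma inj_unit_vector: "inj unit_vector"
  by (rule injI) (metis unit_vector_apply zero_neq_one)

text \<open>Reading coordinate \<open>i\<close> of a vanishing combination isolates the term of
  \<open>t\<close>, so its coefficient is zero and the rest is a relation inside \<open>B\<close>.
  This serves both the unit vectors and each new basis vector in
  \<open>extend_to_basis\<close>.\<close>

lemma independent_insert_coordinate:
  assumes B: "zmod.independent B" and zero: "\<And>v. v \<in> B \<Longrightarrow> v i = 0" and t: "t i \<noteq> 0"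
  shows "zmod.independent (insert t B)"
proof
  assume "zmod.dependent (insert t B)"
  then obtain F u where F: "finite F" "F \<subseteq> insert t B"
    and comb: "(\<Sum>v\<in>F. zscale (u v) v) = 0" and u: "\<exists>v\<in>F. u v \<noteq> 0"
    unfolding zmod.dependent_explicit by blast
  have "u t = 0" if "t \<in> F"
  proof -
    have "0 = (\<Sum>v\<in>F. zscale (u v) v) i"
      by (simp add: comb)
    also have "\<dots> = (\<Sum>v\<in>F. u v * v i)"
      by (simp add: sum_apply_fun zscale_apply)
    also have "\<dots> = u t * t i + (\<Sum>v\<in>F - {t}. u v * v i)"
      using F that by (subst sum.remove[of F t]) auto
    also have "(\<Sum>v\<in>F - {t}. u v * v i) = 0"
      by (rule sum.neutral) (use F zero in auto)
    finally show ?thesis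
      using t by simp
  qed
  then have "(\<Sum>v\<in>F - {t}. zscale (u v) v) = (\<Sum>v\<in>F. zscale (u v) v)"
    using F by (intro sum.mono_neutral_left) auto
  moreover have "\<exists>v\<in>F - {t}. u v \<noteq> 0"
    using u \<open>t \<in> F \<Longrightarrow> u t = 0\<close> by blast
  moreover have "finite (F - {t})" "F - {t} \<subseteq> B"
    using F by auto
  ultimately have "zmod.dependent B"
    unfolding zmod.dependent_explicit using comb by metis
  then show False
    using B by contradiction
qed

lemma independent_unit_vectors: "finite J \<Longrightarrow> zmod.independent (unit_vector ` J)"
proof (induction J rule: finite_induct)
  case empty
  then show ?case by (simp add: zmod.independent_empty)
next
  case (insert i J)
  have "zmod.independent (insert (unit_vector i) (unit_vector ` J))"
  proof (rule independent_insert_coordinate[where i = i])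
    show "v i = 0" if "v \<in> unit_vector ` J" for v
      using that insert.hyps by (auto simp: unit_vector_apply)
    show "unit_vector i i \<noteq> 0"
      by (simp add: unit_vector_apply)
  qed (rule insert.IH)
  then show ?case
    by simp
qed

lemma span_unit_vectors:
  assumes J: "J \<subseteq> {..<n}"
  shows "zmod.span (unit_vector ` J) = {x \<in> int_lattice n. \<forall>i. i \<notin> J \<longrightarrow> x i = 0}"
proof
  have "zmod.subspace {x \<in> int_lattice n. \<forall>i. i \<notin> J \<longrightarrow> x i = 0}"
    by (rule zmod.subspaceI) (auto simp: int_lattice_iff zscale_apply)
  then show "zmod.span (unit_vector ` J) \<subseteq> {x \<in> int_lattice n. \<forall>i. i \<notin> J \<longrightarrow> x i = 0}"
    by (intro zmod.span_minimal) (use J in \<open>auto intro!: unit_vector_in_int_lattice simp: unit_vector_apply\<close>)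
next
  have fin: "finite J"
    using J finite_subset by blast
  show "{x \<in> int_lattice n. \<forall>i. i \<notin> J \<longrightarrow> x i = 0} \<subseteq> zmod.span (unit_vector ` J)"
  proof
    fix x assume x: "x \<in> {x \<in> int_lattice n. \<forall>i. i \<notin> J \<longrightarrow> x i = 0}"
    have "x = (\<Sum>i\<in>J. zscale \<lfloor>x i\<rfloor> (unit_vector i))"
    proof
      fix j
      have "(\<Sum>i\<in>J. zscale \<lfloor>x i\<rfloor> (unit_vector i)) j = (\<Sum>i\<in>J. if i = j then of_int \<lfloor>x i\<rfloor> else 0)"
        by (auto simp: sum_apply_fun unit_vector_apply zscale_apply intro!: sum.cong)
      also have "\<dots> = x j"
        using fin x by (auto simp: int_lattice_iff of_int_floor)
      finally show "x j = (\<Sum>i\<in>J. zscale \<lfloor>x i\<rfloor> (unit_vector i)) j" ..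
    qed
    also have "\<dots> \<in> zmod.span (unit_vector ` J)"
      by (intro zmod.span_sum zmod.span_scale zmod.span_base) auto
    finally show "x \<in> zmod.span (unit_vector ` J)" .
  qed
qed

section \<open>Extending a basis one coordinate at a time\<close>

text \<open>The values of a coordinate \<open>i\<close> on \<open>M\<close> form a subgroup of
  (1/q)Z, hence a cyclic group, and it is nonzero because \<open>M\<close> contains the unit vector.
  A vector \<open>t\<close> attaining a generator splits \<open>M\<close> into its part with
  \<open>x i = 0\<close> and the multiples of \<open>t\<close>; induction on \<open>I\<close>
  handles that part, so every coordinate contributes exactly one vector.\<close>

lemma extend_to_basis:
  assumes "finite I" "zmod.subspace M" "q > 0" "S \<subseteq> M"
    and "\<And>x i. x \<in> M \<Longrightarrow> i \<in> I \<Longrightarrow> of_nat q * x i \<in> \<int>"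
    and "\<And>i. i \<in> I \<Longrightarrow> unit_vector i \<in> M"
    and "{x \<in> M. \<forall>i\<in>I. x i = 0} = zmod.span S" "zmod.independent S"
  shows "\<exists>T\<subseteq>M. finite T \<and> card T = card I \<and> is_lattice_basis (S \<union> T) M"
  using assms
proof (induction I arbitrary: M rule: finite_induct)
  case empty
  then show ?case
    by (intro exI[of _ "{}"]) (auto simp: is_lattice_basis_def)
next
  case (insert i I)
  note M = \<open>zmod.subspace M\<close>
  define M' where "M' = {x \<in> M. x i = 0}"
  have S0: "v i = 0" if "v \<in> S" for v
    using insert.prems(6) zmod.span_base[OF that] by blast
  have sub': "zmod.subspace M'"
    using M unfolding M'_def zmod.subspace_def by (auto simp: zscale_apply)
  have "\<exists>T\<subseteq>M'. finite T \<and> card T = card I \<and> is_lattice_basis (S \<union> T) M'"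
  proof (rule insert.IH[OF sub' \<open>q > 0\<close>])
    show "S \<subseteq> M'"
      using insert.prems(3) S0 by (auto simp: M'_def)
    show "unit_vector j \<in> M'" if "j \<in> I" for j
    proof -
      have "unit_vector j i = 0"
        using that insert.hyps(2) by (auto simp: unit_vector_apply)
      then show ?thesis
        using insert.prems(5)[of j] that by (simp add: M'_def)
    qed
    show "{x \<in> M'. \<forall>i\<in>I. x i = 0} = zmod.span S"
      using insert.prems(6) by (auto simp: M'_def)
  qed (use insert.prems in \<open>auto simp: M'_def\<close>)
  then obtain T where T: "T \<subseteq> M'" "finite T" "card T = card I"
    and ind: "zmod.independent (S \<union> T)" and sp: "zmod.span (S \<union> T) = M'"
    unfolding is_lattice_basis_def by blast
  \<comment> \<open>\<open>Q k\<close> means that \<open>k / q\<close> is a positive value of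
    coordinate \<open>i\<close> on \<open>M\<close>; the least such \<open>k\<close> yields the
    generator.\<close>
  define Q where "Q k \<longleftrightarrow> k > 0 \<and> (\<exists>x\<in>M. of_nat q * x i = of_nat k)" for k :: nat
  have "of_nat q * unit_vector i i = of_nat q"
    by (simp add: unit_vector_apply)
  then have "Q q"
    unfolding Q_def using insert.prems(5)[of i] \<open>q > 0\<close> by blast
  define k where "k = (LEAST k. Q k)"
  have "Q k"
    unfolding k_def using \<open>Q q\<close> by (rule LeastI)
  then obtain t where t: "t \<in> M" "of_nat q * t i = of_nat k" and k: "k > 0"
    unfolding Q_def by blast
  have t0: "t i \<noteq> 0"
    using t k by auto
  \<comment> \<open>Division with remainder: subtracting a suitable multiple of \<open>t\<close>
    leaves the value \<open>(z mod k) / q\<close>, which is 0 by minimality of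
    \<open>k\<close>.\<close>
  have dec: "\<exists>c. x - zscale c t \<in> M'" if x: "x \<in> M" for x
  proof -
    obtain z where z: "of_nat q * x i = of_int z"
      using insert.prems(4)[OF x, of i] by (auto elim: Ints_cases)
    define y where "y = x - zscale (z div int k) t"
    have y: "y \<in> M"
      unfolding y_def using x t M by (intro zmod.subspace_diff zmod.subspace_scale)
    have "of_nat q * y i = of_int z - of_int (z div int k) * of_nat k"
      using z t by (simp add: y_def zscale_apply algebra_simps)
    also have "\<dots> = of_int (z - (z div int k) * int k)"
      by simp
    also have "z - (z div int k) * int k = z mod int k"
      by (simp add: minus_div_mult_eq_mod)
    also have "\<dots> = int (nat (z mod int k))"
      using k by simp
    finally have eq: "of_nat q * y i = of_nat (nat (z mod int k))"
      by simp
    have "nat (z mod int k) < k"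
      using k by (simp add: nat_less_iff)
    then have "\<not> Q (nat (z mod int k))"
      unfolding k_def by (rule not_less_Least)
    then have "nat (z mod int k) = 0"
      using y eq unfolding Q_def by (metis gr0I)
    then have "y i = 0"
      using eq \<open>q > 0\<close> by (metis mult_eq_0_iff of_nat_0 of_nat_eq_0_iff less_irrefl)
    then show ?thesis
      using y unfolding y_def M'_def by blast
  qed
  have tT: "t \<notin> T"
    using T t0 by (auto simp: M'_def)
  have ind': "zmod.independent (S \<union> insert t T)"
    using independent_insert_coordinate[OF ind, of i t] S0 T t0 by (auto simp: M'_def)
  have sub: "S \<union> insert t T \<subseteq> M"
    using insert.prems(3) T t by (auto simp: M'_def)
  have "M \<subseteq> zmod.span (S \<union> insert t T)"
  proof
    fix x assume "x \<in> M"
    then obtain c where c: "x - zscale c t \<in> M'"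
      using dec by blast
    then have "x - zscale c t \<in> zmod.span (S \<union> insert t T)"
      using sp zmod.span_mono[of "S \<union> T" "S \<union> insert t T"] by blast
    moreover have "zscale c t \<in> zmod.span (S \<union> insert t T)"
      by (intro zmod.span_scale zmod.span_base) auto
    ultimately have "(x - zscale c t) + zscale c t \<in> zmod.span (S \<union> insert t T)"
      by (rule zmod.span_add)
    then show "x \<in> zmod.span (S \<union> insert t T)"
      by simp
  qed
  then have "is_lattice_basis (S \<union> insert t T) M"
    unfolding is_lattice_basis_def using ind' zmod.span_minimal[OF sub M] by blast
  then show ?case
    using T t tT insert.hyps sub by (intro exI[of _ "insert t T"]) auto
qed

section \<open>Torsion of the quotient by the integer lattice\<close>

definition frac_vec :: "(nat \<Rightarrow> real) \<Rightarrow> (nat \<Rightarrow> real)" where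
  "frac_vec x = (\<lambda>i. frac (x i))"

locale lattice_above_int =
  fixes n :: nat and \<Lambda> :: "(nat \<Rightarrow> real) set"
  assumes subspace: "zmod.subspace \<Lambda>"
    and int_lattice_subset: "int_lattice n \<subseteq> \<Lambda>"
    and subset_real_space: "\<Lambda> \<subseteq> real_space n"
begin

text \<open>These are the classes of Lambda / Z^n killed by \<open>d\<close> and trivial on
  \<open>I\<close>. Each class is encoded by its unique representative in the half-open unit cube,
  so the group operation is addition followed by \<open>frac_vec\<close>.\<close>

definition torsion :: "nat \<Rightarrow> nat set \<Rightarrow> (nat \<Rightarrow> real) set" where
  "torsion d I = {x \<in> \<Lambda>. (\<forall>i. 0 \<le> x i \<and> x i < 1) \<and> zscale (int d) x \<in> int_lattice n \<and>
    (\<forall>i\<in>I. x i = 0)}"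

definition torsion_support :: "nat \<Rightarrow> nat set \<Rightarrow> nat set" where
  "torsion_support d I = {i. \<exists>x\<in>torsion d I. x i \<noteq> 0}"

text \<open>For a prime \<open>p\<close> and a finite torsion group this is the dimension over the
  field with \<open>p\<close> elements. As a logarithm of a cardinality it can be estimated from
  inequalities between cardinalities alone.\<close>

definition rk :: "nat \<Rightarrow> nat set \<Rightarrow> real" where
  "rk p I = log (real p) (real (card (torsion p I)))"

lemma vanish: "x \<in> \<Lambda> \<Longrightarrow> n \<le> i \<Longrightarrow> x i = 0"
  using subset_real_space by (auto simp: real_space_def)

lemma diff_mem: "x \<in> \<Lambda> \<Longrightarrow> y \<in> \<Lambda> \<Longrightarrow> x - y \<in> \<Lambda>"
  using subspace by (rule zmod.subspace_diff)

lemma add_mem: "x \<in> \<Lambda> \<Longrightarrow> y \<in> \<Lambda> \<Longrightarrow> x + y \<in> \<Lambda>"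
  using subspace by (rule zmod.subspace_add)

lemma scale_mem: "x \<in> \<Lambda> \<Longrightarrow> zscale k x \<in> \<Lambda>"
  using subspace by (rule zmod.subspace_scale)

lemma zero_in_torsion: "0 \<in> torsion d I"
  using zmod.subspace_0[OF subspace]
  by (auto simp: torsion_def int_lattice_iff zscale_apply)

lemma torsion_antimono: "I \<subseteq> J \<Longrightarrow> torsion d J \<subseteq> torsion d I"
  by (auto simp: torsion_def)

lemma torsion_support_subset: "torsion_support d I \<subseteq> {..<n}"
proof
  fix i assume "i \<in> torsion_support d I"
  then obtain x where "x \<in> \<Lambda>" "x i \<noteq> 0"
    by (auto simp: torsion_support_def torsion_def)
  then show "i \<in> {..<n}"
    using vanish[of x i] by (cases "n \<le> i") auto
qed

lemma frac_vec_mem: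
  assumes "x \<in> \<Lambda>"
  shows "frac_vec x \<in> \<Lambda>"
proof -
  have "x - frac_vec x \<in> int_lattice n"
    using assms vanish[OF assms] by (auto simp: int_lattice_iff frac_vec_def frac_def)
  then have "x - (x - frac_vec x) \<in> \<Lambda>"
    using assms int_lattice_subset by (blast intro: diff_mem)
  then show ?thesis
    by simp
qed

lemma frac_vec_in_torsion:
  assumes "x \<in> \<Lambda>" "\<And>i. of_nat d * x i \<in> \<int>" "\<And>i. i \<in> I \<Longrightarrow> x i \<in> \<int>"
  shows "frac_vec x \<in> torsion d I"
proof -
  have "of_nat d * frac (x i) \<in> \<int>" for i
    using assms(2)[of i] by (simp add: frac_def right_diff_distrib)
  moreover have "x i = 0" if "n \<le> i" for i
    using assms(1) that by (rule vanish)
  ultimately have "zscale (int d) (frac_vec x) \<in> int_lattice n"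
    by (auto simp: int_lattice_iff zscale_apply frac_vec_def)
  then show ?thesis
    using assms frac_vec_mem[OF assms(1)]
    by (auto simp: torsion_def frac_vec_def frac_lt_1)
qed

lemma torsion_int: "x \<in> torsion d I \<Longrightarrow> of_nat d * x i \<in> \<int>"
  by (auto simp: torsion_def int_lattice_iff zscale_apply)

lemma torsion_eqI:
  assumes "x \<in> torsion d I" "y \<in> torsion e J" "\<And>i. x i - y i \<in> \<int>"
  shows "x = y"
proof
  fix i
  have "\<bar>x i - y i\<bar> < 1"
    using assms(1,2) by (auto simp: torsion_def abs_less_iff) (smt (verit))+
  then show "x i = y i"
    using assms(3)[of i] Ints_nonzero_abs_less1 by force
qed

text \<open>The injection is \<open>(x, j) \<mapsto> x + j g\<close> modulo the integer lattice.\<close>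

lemma card_torsion_insert:
  assumes p: "prime p" and g: "g \<in> torsion p I" "g i \<noteq> 0" and fin: "finite (torsion p I)"
  shows "p * card (torsion p (insert i I)) \<le> card (torsion p I)"
proof -
  define f where "f = (\<lambda>(x, j). frac_vec (x + zscale (int j) g))"
  have "inj_on f (torsion p (insert i I) \<times> {..<p})"
  proof (rule inj_onI, clarify)
    fix x j y k
    assume x: "x \<in> torsion p (insert i I)" and y: "y \<in> torsion p (insert i I)"
      and jk: "j < p" "k < p" and eq: "f (x, j) = f (y, k)"
    have diff: "(x l + of_nat j * g l) - (y l + of_nat k * g l) \<in> \<int>" for l
    proof -
      have "frac (x l + of_nat j * g l) = frac (y l + of_nat k * g l)"
        using fun_cong[OF eq, of l] by (simp add: f_def frac_vec_def zscale_apply)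
      then have "(x l + of_nat j * g l) - (y l + of_nat k * g l)
          = of_int \<lfloor>x l + of_nat j * g l\<rfloor> - of_int \<lfloor>y l + of_nat k * g l\<rfloor>"
        unfolding frac_def by linarith
      then show ?thesis
        by simp
    qed
    \<comment> \<open>Both \<open>x\<close> and \<open>y\<close> vanish at \<open>i\<close>, so
      \<open>(j - k) * g i\<close> is an integer. Since \<open>g i = a / p\<close> lies strictly
      between 0 and 1, \<open>p\<close> does not divide \<open>a\<close> and must divide
      \<open>j - k\<close>.\<close>
    obtain a where a: "of_nat p * g i = of_int a"
      using torsion_int[OF g(1), of i] by (auto elim: Ints_cases)
    have "x i = 0" "y i = 0"
      using x y by (auto simp: torsion_def)
    then obtain b where "(of_nat j - of_nat k) * g i = of_int b"
      using diff[of i] by (auto simp: left_diff_distrib elim: Ints_cases)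
    then have "(of_nat j - of_nat k) * (of_nat p * g i) = of_nat p * of_int b"
      by (simp add: algebra_simps)
    then have "of_int ((int j - int k) * a) = (of_int (int p * b) :: real)"
      by (simp add: a)
    then have "int p dvd (int j - int k) * a"
      by (metis dvd_triv_left of_int_eq_iff)
    moreover have "\<not> int p dvd a"
    proof
      assume "int p dvd a"
      then obtain c where "a = int p * c" ..
      then have "g i = of_int c"
        using a prime_gt_0_nat[OF p] by simp
      moreover have "0 \<le> g i" "g i < 1"
        using g by (auto simp: torsion_def)
      ultimately show False
        using g by simp
    qed
    ultimately have "int p dvd int j - int k"
      using p by (simp add: prime_dvd_mult_iff)
    then have jk': "j = k"
      using jk by (metis mod_eq_dvd_iff mod_less zmod_int of_nat_eq_iff)
    then have "x = y"
      using diff by (intro torsion_eqI[OF x y]) simp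
    with jk' show "x = y \<and> j = k"
      by simp
  qed
  moreover have "f ` (torsion p (insert i I) \<times> {..<p}) \<subseteq> torsion p I"
  proof clarify
    fix x j assume x: "x \<in> torsion p (insert i I)"
    have "of_nat p * (x + zscale (int j) g) l \<in> \<int>" for l
      using torsion_int[OF x, of l] torsion_int[OF g(1), of l]
      by (simp add: zscale_apply distrib_left mult.left_commute[of "of_nat p"])
    moreover have "(x + zscale (int j) g) l \<in> \<int>" if "l \<in> I" for l
      using x g that by (auto simp: zscale_apply torsion_def)
    moreover have "x + zscale (int j) g \<in> \<Lambda>"
      using x g by (intro add_mem scale_mem) (auto simp: torsion_def)
    ultimately show "f (x, j) \<in> torsion p I"
      unfolding f_def by (simp add: frac_vec_in_torsion)
  qed
  ultimately have "card (torsion p (insert i I) \<times> {..<p}) \<le> card (torsion p I)"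
    using fin by (rule card_inj_on_le)
  then show ?thesis
    by (simp add: card_cartesian_product mult.commute)
qed

text \<open>Addition modulo the integer lattice is injective on pairs: if two sums agree,
  \<open>x - x'\<close> and \<open>y' - y\<close> are congruent, so both are killed by
  \<open>a\<close> and by \<open>b\<close>, hence integral by Bezout.\<close>

lemma card_torsion_coprime:
  assumes ab: "coprime a b" and fin: "finite (torsion (a * b) I)"
  shows "card (torsion a I) * card (torsion b I) \<le> card (torsion (a * b) I)"
proof -
  define f where "f = (\<lambda>(x, y). frac_vec (x + y))"
  obtain u v where uv: "u * int a + v * int b = 1"
    using bezout_int[of "int a" "int b"] ab by auto
  have int: "w l \<in> \<int>" if "of_nat a * w l \<in> \<int>" "of_nat b * w l \<in> \<int>" for w :: "nat \<Rightarrow> real" and l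
  proof -
    have "w l = of_int (u * int a + v * int b) * w l"
      by (simp add: uv)
    also have "\<dots> = of_int u * (of_nat a * w l) + of_int v * (of_nat b * w l)"
      by (simp add: algebra_simps)
    also have "\<dots> \<in> \<int>"
      by (intro Ints_add Ints_mult[OF Ints_of_int] that)
    finally show ?thesis .
  qed
  have "inj_on f (torsion a I \<times> torsion b I)"
  proof (rule inj_onI, clarify)
    fix x y x' y'
    assume x: "x \<in> torsion a I" "x' \<in> torsion a I" and y: "y \<in> torsion b I" "y' \<in> torsion b I"
      and eq: "f (x, y) = f (x', y')"
    have diff: "(x l - x' l) - (y' l - y l) \<in> \<int>" for l
    proof -
      have "frac (x l + y l) = frac (x' l + y' l)"
        using fun_cong[OF eq, of l] by (simp add: f_def frac_vec_def)
      then have "(x l - x' l) - (y' l - y l) = of_int \<lfloor>x l + y l\<rfloor> - of_int \<lfloor>x' l + y' l\<rfloor>"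
        unfolding frac_def by linarith
      then show ?thesis
        by simp
    qed
    have ax: "of_nat a * (x l - x' l) \<in> \<int>" and bY: "of_nat b * (y' l - y l) \<in> \<int>" for l
      using x y torsion_int by (simp_all add: right_diff_distrib)
    have bx: "of_nat b * (x l - x' l) \<in> \<int>" for l
    proof -
      have "of_nat b * (x l - x' l) = of_nat b * ((x l - x' l) - (y' l - y l)) + of_nat b * (y' l - y l)"
        by (simp add: algebra_simps)
      also have "\<dots> \<in> \<int>"
        by (intro Ints_add Ints_mult diff bY) auto
      finally show ?thesis .
    qed
    have xl: "x l - x' l \<in> \<int>" for l
      using int[of "\<lambda>l. x l - x' l" l] ax bx by simp
    have "y' l - y l \<in> \<int>" for l
      using Ints_diff[OF xl[of l] diff[of l]] by simp
    then have "y' = y"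
      by (intro torsion_eqI[OF y(2,1)])
    moreover have "x = x'"
      using xl by (intro torsion_eqI[OF x])
    ultimately show "x = x' \<and> y = y'"
      by simp
  qed
  moreover have "f ` (torsion a I \<times> torsion b I) \<subseteq> torsion (a * b) I"
  proof clarify
    fix x y assume x: "x \<in> torsion a I" and y: "y \<in> torsion b I"
    have "of_nat (a * b) * (x + y) l \<in> \<int>" for l
    proof -
      have "of_nat (a * b) * (x + y) l = of_nat b * (of_nat a * x l) + of_nat a * (of_nat b * y l)"
        by (simp add: algebra_simps)
      also have "\<dots> \<in> \<int>"
        by (intro Ints_add Ints_mult torsion_int[OF x] torsion_int[OF y]) auto
      finally show ?thesis .
    qed
    moreover have "x + y \<in> \<Lambda>"
      using x y by (intro add_mem) (auto simp: torsion_def)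
    moreover have "(x + y) l \<in> \<int>" if "l \<in> I" for l
      using x y that by (auto simp: torsion_def)
    ultimately show "f (x, y) \<in> torsion (a * b) I"
      unfolding f_def by (simp add: frac_vec_in_torsion)
  qed
  ultimately have "card (torsion a I \<times> torsion b I) \<le> card (torsion (a * b) I)"
    using fin by (rule card_inj_on_le)
  then show ?thesis
    by (simp add: card_cartesian_product)
qed

section \<open>Bounding the defect by a set of coordinates\<close>

text \<open>By \<open>prim\<close>, the lattice vectors vanishing on \<open>I\<close> are integral,
  so the unit vectors outside \<open>I\<close> are a basis of that sublattice, and
  \<open>extend_to_basis\<close> completes it with \<open>card I\<close> vectors.\<close>

lemma defect_le_card:
  assumes I: "I \<subseteq> {..<n}" and q: "q > 0"
    and denom: "\<And>x i. x \<in> \<Lambda> \<Longrightarrow> of_nat q * x i \<in> \<int>"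
    and prim: "\<And>x. x \<in> \<Lambda> \<Longrightarrow> (\<And>i. i \<in> I \<Longrightarrow> x i = 0) \<Longrightarrow> x \<in> int_lattice n"
  shows "defect n \<Lambda> \<le> card I"
proof -
  define S where "S = unit_vector ` ({..<n} - I)"
  have fin: "finite I"
    using I finite_subset by blast
  have S: "zmod.span S = {x \<in> \<Lambda>. \<forall>i\<in>I. x i = 0}"
    unfolding S_def
  proof (subst span_unit_vectors[of _ n])
    show "{x \<in> int_lattice n. \<forall>i. i \<notin> {..<n} - I \<longrightarrow> x i = 0} = {x \<in> \<Lambda>. \<forall>i\<in>I. x i = 0}"
      using int_lattice_subset prim vanish I by (auto simp: not_less)
  qed auto
  have "\<exists>T\<subseteq>\<Lambda>. finite T \<and> card T = card I \<and> is_lattice_basis (S \<union> T) \<Lambda>"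
  proof (rule extend_to_basis[OF fin subspace q])
    show "S \<subseteq> \<Lambda>"
      using S zmod.span_superset[of S] by blast
    show "unit_vector i \<in> \<Lambda>" if "i \<in> I" for i
      using that I int_lattice_subset unit_vector_in_int_lattice by blast
    show "zmod.independent S"
      unfolding S_def by (rule independent_unit_vectors) auto
  qed (use denom S in auto)
  moreover have "card S = n - card I"
    using I fin by (simp add: S_def card_image inj_on_subset[OF inj_unit_vector] card_Diff_subset)
  moreover have "S \<subseteq> std_basis n" "card I \<le> n"
    using I card_mono[OF _ I] by (auto simp: S_def std_basis_def)
  ultimately show ?thesis
    unfolding defect_def by (intro Least_le conjI) blast+
qed

text \<open>Testing prime torsion suffices: if \<open>d = p * e\<close> kills the class of
  \<open>x\<close>, then \<open>e x\<close> is \<open>p\<close>-torsion, hence integral, so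
  \<open>e\<close> already kills it. Removing one prime at a time brings the denominator down to
  1.\<close>

lemma defect_le_if_torsion_trivial:
  assumes I: "I \<subseteq> {..<n}" and q: "q > 0"
    and denom: "\<And>x i. x \<in> \<Lambda> \<Longrightarrow> of_nat q * x i \<in> \<int>"
    and triv: "\<And>p. p \<in> prime_factors q \<Longrightarrow> torsion p I = {0}"
  shows "defect n \<Lambda> \<le> card I"
proof (rule defect_le_card[OF I q])
  have *: "\<forall>i. x i \<in> \<int>"
    if "d dvd q" "x \<in> \<Lambda>" "\<forall>i\<in>I. x i \<in> \<int>" "\<forall>i. of_nat d * x i \<in> \<int>" for d x
    using that
  proof (induction d arbitrary: x rule: less_induct)
    case (less d)
    show ?case
    proof (cases "d = 1")
      case True
      then show ?thesis using less.prems by simp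
    next
      case False
      then obtain p where p: "prime p" "p dvd d"
        using prime_factor_nat by blast
      then obtain e where e: "d = p * e"
        by (auto elim: dvdE)
      have d0: "d > 0"
        using less.prems(1) q by (auto intro: Nat.gr0I)
      have e_less: "e < d"
        using e d0 prime_gt_1_nat[OF p(1)] by (simp add: n_less_m_mult_n)
      have pq: "p \<in> prime_factors q"
        using p less.prems(1) q by (auto simp: prime_factors_dvd)
      define y where "y = zscale (int e) x"
      have "frac_vec y \<in> torsion p I"
      proof (rule frac_vec_in_torsion)
        show "of_nat p * y i \<in> \<int>" for i
          using less.prems(4) by (simp add: y_def zscale_apply e mult.assoc)
      qed (use less.prems in \<open>auto simp: y_def zscale_apply intro: scale_mem\<close>)
      then have "frac_vec y = 0"
        using triv[OF pq] by blast
      then have "frac (y i) = 0" for i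
        by (metis frac_vec_def zero_fun_apply)
      then have "\<forall>i. of_nat e * x i \<in> \<int>"
        by (simp add: y_def zscale_apply)
      moreover have "e dvd q"
        using less.prems(1) e dvd_mult_right by blast
      ultimately show ?thesis
        using less.IH[OF e_less] less.prems by blast
    qed
  qed
  fix x assume "x \<in> \<Lambda>" "\<And>i. i \<in> I \<Longrightarrow> x i = 0"
  then show "x \<in> int_lattice n"
    using *[of q x] denom vanish by (auto simp: int_lattice_iff)
qed (rule denom)

lemma defect_le_dimension:
  assumes "q > 0" "\<And>x i. x \<in> \<Lambda> \<Longrightarrow> of_nat q * x i \<in> \<int>"
  shows "defect n \<Lambda> \<le> n"
proof -
  have "x \<in> int_lattice n" if "x \<in> \<Lambda>" "\<And>i. i \<in> {..<n} \<Longrightarrow> x i = 0" for x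
    using that vanish[OF that(1)] by (auto simp: int_lattice_iff) (metis Ints_0 linorder_not_less)
  then show ?thesis
    using defect_le_card[of "{..<n}" q] assms by auto
qed

end

section \<open>Admissibility and the pigeonhole principle\<close>

locale admissible_lattice = lattice_above_int +
  assumes admissible: "admissible n \<Lambda>"
begin

lemma zero_if_norm_less_1:
  assumes x: "x \<in> \<Lambda>" and norm: "(\<Sum>i<n. \<bar>x i\<bar>) < 1"
  shows "x = 0"
proof -
  have unit: "(\<Sum>j<n. \<bar>unit_vector i j\<bar>) = 1" if "i < n" for i
    using that by (simp add: unit_vector_def if_distrib cong: if_cong)
  have "x \<in> octahedron n \<inter> \<Lambda>"
    using x norm subset_real_space by (auto simp: octahedron_def)
  then consider "x = 0" | i where "i < n" "x = unit_vector i" | i where "i < n" "x = - unit_vector i"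
    using admissible unfolding admissible_def std_basis_def by auto
  then show ?thesis
    using norm unit by cases auto
qed

text \<open>Cut the unit cube over \<open>U\<close> into \<open>s ^ s\<close> cells of side
  \<open>1 / s\<close>, where \<open>s = card U\<close>; \<open>f\<close> records the cell of a
  point. Two points of one cell differ by a lattice vector of norm below
  \<open>s * (1 / s) = 1\<close>, which is zero by admissibility. For empty \<open>U\<close> the
  bound reads \<open>0 ^ 0 = 1\<close> and accounts for the zero vector.\<close>

lemma card_le_support_power:
  assumes A: "A \<subseteq> \<Lambda>" "\<And>x i. x \<in> A \<Longrightarrow> 0 \<le> x i \<and> x i < 1"
    and U: "U \<subseteq> {..<n}" "\<And>x i. x \<in> A \<Longrightarrow> i \<notin> U \<Longrightarrow> x i = 0"
  shows "finite A \<and> card A \<le> card U ^ card U"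
proof -
  define s where "s = card U"
  have finU: "finite U"
    using U(1) by (rule finite_subset) simp
  define f where "f = (\<lambda>x :: nat \<Rightarrow> real. restrict (\<lambda>i. nat \<lfloor>of_nat s * x i\<rfloor>) U)"
  have inj: "inj_on f A"
  proof (rule inj_onI)
    fix x y assume x: "x \<in> A" and y: "y \<in> A" and eq: "f x = f y"
    have diff: "of_nat s * \<bar>x i - y i\<bar> < 1" if i: "i \<in> U" for i
    proof -
      have "nat \<lfloor>of_nat s * x i\<rfloor> = nat \<lfloor>of_nat s * y i\<rfloor>"
        using fun_cong[OF eq, of i] i by (simp add: f_def)
      moreover have "0 \<le> of_nat s * x i" "0 \<le> of_nat s * y i"
        using A(2)[OF x, of i] A(2)[OF y, of i] by auto
      ultimately have "\<lfloor>of_nat s * x i\<rfloor> = \<lfloor>of_nat s * y i\<rfloor>"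
        by (metis eq_nat_nat_iff zero_le_floor)
      then have "\<bar>of_nat s * x i - of_nat s * y i\<bar> < 1"
        by linarith
      moreover have "of_nat s * \<bar>x i - y i\<bar> = \<bar>of_nat s * x i - of_nat s * y i\<bar>"
        by (metis abs_mult abs_of_nat right_diff_distrib)
      ultimately show ?thesis
        by simp
    qed
    have "(\<Sum>i<n. \<bar>(x - y) i\<bar>) = (\<Sum>i\<in>U. \<bar>x i - y i\<bar>)"
      using U(1) U(2)[OF x] U(2)[OF y] by (intro sum.mono_neutral_cong_right) auto
    also have "\<dots> < 1"
    proof (cases "U = {}")
      case False
      then have s: "s > 0"
        using finU by (auto simp: s_def card_gt_0_iff)
      have "\<bar>x i - y i\<bar> < 1 / of_nat s" if "i \<in> U" for i
        using diff[OF that] s by (simp add: pos_less_divide_eq mult.commute)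
      then have "(\<Sum>i\<in>U. \<bar>x i - y i\<bar>) < (\<Sum>i\<in>U. 1 / of_nat s)"
        by (intro sum_strict_mono finU False)
      also have "\<dots> = 1"
        using s by (simp add: s_def)
      finally show ?thesis .
    qed simp
    finally have "x - y = 0"
      using x y A(1) by (intro zero_if_norm_less_1 diff_mem) auto
    then show "x = y"
      by simp
  qed
  have "f ` A \<subseteq> PiE U (\<lambda>_. {..<s})"
  proof clarify
    fix x assume x: "x \<in> A"
    have "nat \<lfloor>of_nat s * x i\<rfloor> < s" if "i \<in> U" for i
    proof -
      have "s > 0"
        using that finU by (auto simp: s_def card_gt_0_iff)
      then have "of_nat s * x i < of_nat s" "0 \<le> of_nat s * x i"
        using A(2)[OF x, of i] by auto
      then show ?thesis
        by (simp add: nat_less_iff floor_less_iff)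
    qed
    then show "f x \<in> PiE U (\<lambda>_. {..<s})"
      by (auto simp: f_def)
  qed
  moreover have "finite (PiE U (\<lambda>_. {..<s}))"
    using finU by (intro finite_PiE) auto
  moreover have "card (PiE U (\<lambda>_. {..<s})) = s ^ s"
    using finU by (simp add: card_PiE s_def)
  ultimately show ?thesis
    using inj_on_finite[OF inj, of "PiE U (\<lambda>_. {..<s})"] card_inj_on_le[OF inj, of "PiE U (\<lambda>_. {..<s})"]
    by (simp add: s_def)
qed

lemma card_torsion_le_support:
  "card (torsion d I) \<le> card (torsion_support d I) ^ card (torsion_support d I)"
proof (rule card_le_support_power[THEN conjunct2])
  show "x i = 0" if "x \<in> torsion d I" "i \<notin> torsion_support d I" for x i
    using that by (auto simp: torsion_support_def)
qed (use torsion_support_subset in \<open>auto simp: torsion_def\<close>)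

lemma finite_torsion: "finite (torsion d I)"
  and card_torsion_le: "card (torsion d I) \<le> n ^ n"
proof -
  have "finite (torsion d I) \<and> card (torsion d I) \<le> card {..<n} ^ card {..<n}"
    by (rule card_le_support_power) (auto simp: torsion_def intro: vanish)
  then show "finite (torsion d I)" "card (torsion d I) \<le> n ^ n"
    by simp_all
qed

lemma card_torsion_pos: "card (torsion d I) > 0"
  using finite_torsion[of d I] zero_in_torsion[of d I] by (simp add: card_gt_0_iff) blast

text \<open>Distinct primes are coprime, so \<open>card_torsion_coprime\<close> can be iterated.
  This lets one bound on the order of a torsion group control all primes simultaneously.\<close>

lemma prod_card_torsion_le:
  assumes "finite P" "\<And>p. p \<in> P \<Longrightarrow> prime p"
  shows "(\<Prod>p\<in>P. card (torsion p {})) \<le> card (torsion (\<Prod>P) {})"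
  using assms
proof (induction P rule: finite_induct)
  case empty
  then show ?case using card_torsion_pos[of 1 "{}"] by simp
next
  case (insert p P)
  have "coprime p (\<Prod>P)"
    using insert.hyps insert.prems
    by (intro prod_coprime_right) (metis insertCI primes_coprime)
  then have "card (torsion p {}) * card (torsion (\<Prod>P) {}) \<le> card (torsion (\<Prod>(insert p P)) {})"
    using card_torsion_coprime[of p "\<Prod>P" "{}"] finite_torsion insert.hyps by simp
  moreover have "card (torsion p {}) * (\<Prod>p\<in>P. card (torsion p {}))
      \<le> card (torsion p {}) * card (torsion (\<Prod>P) {})"
    using insert by (intro mult_left_mono) auto
  ultimately have "card (torsion p {}) * (\<Prod>p\<in>P. card (torsion p {})) \<le> card (torsion (\<Prod>(insert p P)) {})"
    by (rule order_trans[rotated])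
  then show ?case
    using insert.hyps by simp
qed

section \<open>Ranks of the prime torsion groups\<close>

lemma rk_nonneg: "prime p \<Longrightarrow> 0 \<le> rk p I"
  using card_torsion_pos[of p I] prime_gt_1_nat[of p] by (auto simp: rk_def zero_le_log_cancel_iff)

lemma rk_mult_ln: "prime p \<Longrightarrow> rk p I * ln p = ln (card (torsion p I))"
  using prime_gt_1_nat[of p] by (simp add: rk_def log_def)

lemma rk_antimono: "prime p \<Longrightarrow> I \<subseteq> J \<Longrightarrow> rk p J \<le> rk p I"
  using card_torsion_pos[of p I] card_torsion_pos[of p J] prime_gt_1_nat[of p]
    card_mono[OF finite_torsion torsion_antimono[of I J p]]
  by (simp add: rk_def)

text \<open>A coordinate in the support is not identically zero on the torsion group, so its kernel
  has index at least \<open>p\<close>; this is \<open>card_torsion_insert\<close> after taking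
  logarithms.\<close>

lemma rk_insert_le:
  assumes p: "prime p" and i: "i \<in> torsion_support p I"
  shows "rk p (insert i I) \<le> rk p I - 1"
proof -
  obtain g where "g \<in> torsion p I" "g i \<noteq> 0"
    using i by (auto simp: torsion_support_def)
  then have "p * card (torsion p (insert i I)) \<le> card (torsion p I)"
    using p finite_torsion by (intro card_torsion_insert)
  then have "real p * card (torsion p (insert i I)) \<le> card (torsion p I)"
    by (metis of_nat_le_iff of_nat_mult)
  then have "log p (real p * card (torsion p (insert i I))) \<le> log p (card (torsion p I))"
    using p card_torsion_pos prime_gt_1_nat[of p] by (subst log_le_cancel_iff) auto
  then show ?thesis
    using card_torsion_pos[of p "insert i I"] prime_gt_1_nat[OF p]
    by (simp add: rk_def log_mult_pos)
qed

lemma sum_rk_insert_le: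
  assumes "finite P" "\<And>p. p \<in> P \<Longrightarrow> prime p"
  shows "(\<Sum>p\<in>P. rk p (insert i I)) \<le> (\<Sum>p\<in>P. rk p I) - card {p \<in> P. i \<in> torsion_support p I}"
proof -
  have "(\<Sum>p\<in>P. rk p (insert i I)) \<le> (\<Sum>p\<in>P. rk p I - (if i \<in> torsion_support p I then 1 else 0))"
    using assms rk_insert_le rk_antimono[OF _ subset_insertI[of I i]] by (intro sum_mono) auto
  also have "\<dots> = (\<Sum>p\<in>P. rk p I) - card {p \<in> P. i \<in> torsion_support p I}"
    using assms by (simp add: sum_subtractf sum.If_cases Int_def)
  finally show ?thesis .
qed

text \<open>Weighted by \<open>ln p\<close>, the ranks add up to the logarithm of a product of
  torsion orders. That product is at most the order of the torsion for the exponent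
  \<open>\<Prod>P\<close>, hence at most \<open>n ^ n\<close>, and each weight is at least
  \<open>ln T\<close>.\<close>

lemma sum_rk_le:
  assumes P: "finite P" "\<And>p. p \<in> P \<Longrightarrow> prime p" and T: "T > 1" "\<And>p. p \<in> P \<Longrightarrow> T < real p"
    and n: "n > 0"
  shows "(\<Sum>p\<in>P. rk p {}) * ln T \<le> n * ln n"
proof -
  have "(\<Sum>p\<in>P. rk p {}) * ln T \<le> (\<Sum>p\<in>P. rk p {} * ln p)"
    unfolding sum_distrib_right
  proof (intro sum_mono mult_left_mono)
    fix p assume "p \<in> P"
    then show "ln T \<le> ln p" "0 \<le> rk p {}"
      using T(1) T(2)[of p] rk_nonneg P(2) by auto
  qed
  also have "\<dots> = (\<Sum>p\<in>P. ln (card (torsion p {})))"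
    using P by (simp add: rk_mult_ln)
  also have "\<dots> = ln (\<Prod>p\<in>P. card (torsion p {}))"
    using P card_torsion_pos by (subst ln_prod[symmetric]) (auto simp: of_nat_prod)
  also have "\<dots> \<le> ln (real (n ^ n))"
    using prod_card_torsion_le[OF P] card_torsion_le[of "\<Prod>P" "{}"] card_torsion_pos P(1)
    by (subst ln_le_cancel_iff) (auto simp: prod_pos n simp del: of_nat_power of_nat_prod)
  also have "\<dots> = n * ln n"
    using n by (simp add: ln_realpow)
  finally show ?thesis .
qed

text \<open>By the pigeonhole principle \<open>p\<^sup>r \<le> s\<^sup>s\<close> for a torsion group of rank \<open>r\<close> supported on
  \<open>s\<close> coordinates; hence \<open>s < lam r\<close> would give \<open>ln p < lam ln (lam m)\<close>.\<close>

lemma support_ge: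
  fixes lam :: real
  assumes p: "prime p" "T \<le> real p" "T > 0" and rk: "rk p I \<le> m"
    and lam: "lam > 0" "lam * ln (lam * m) \<le> ln T"
  shows "lam * rk p I \<le> card (torsion_support p I)"
proof (rule ccontr)
  define s where "s = real (card (torsion_support p I))"
  define r where "r = rk p I"
  assume "\<not> lam * rk p I \<le> card (torsion_support p I)"
  then have less: "s < lam * r"
    by (simp add: s_def r_def)
  have fin: "finite (torsion_support p I)"
    using torsion_support_subset finite_subset by blast
  have "s \<ge> 0"
    by (simp add: s_def)
  then have r: "r > 0"
    using less lam by (smt (verit) mult_le_0_iff)
  \<comment> \<open>An empty support would leave at most \<open>0 ^ 0 = 1\<close> element and thus
    rank 0. So \<open>s \<ge> 1\<close>, which makes \<open>ln s\<close> usable.\<close>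
  have "torsion_support p I \<noteq> {}"
  proof
    assume "torsion_support p I = {}"
    then have "card (torsion p I) \<le> 1"
      using card_torsion_le_support[of p I] by simp
    then have "r = 0"
      using card_torsion_pos[of p I] by (simp add: r_def rk_def le_Suc_eq)
    then show False using r by simp
  qed
  then have s: "s \<ge> 1"
    using fin by (simp add: s_def Suc_le_eq card_gt_0_iff)
  have "r * ln p \<le> ln (real (card (torsion_support p I) ^ card (torsion_support p I)))"
    unfolding r_def rk_mult_ln[OF p(1)]
    using card_torsion_pos card_torsion_le_support[of p I] s
    by (subst ln_le_cancel_iff) (auto simp: s_def simp del: of_nat_power)
  also have "\<dots> = s * ln s"
    using s by (simp add: s_def ln_realpow)
  also have "\<dots> \<le> s * ln (lam * m)"
  proof -
    have "s \<le> lam * m"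
      using less rk lam by (smt (verit) mult_left_mono r_def)
    then show ?thesis
      using s by (intro mult_left_mono) auto
  qed
  finally have le: "r * ln p \<le> s * ln (lam * m)" .
  have lnp: "ln T \<le> ln p" "0 < ln p"
    using p prime_gt_1_nat[of p] by auto
  \<comment> \<open>The logarithm has to be positive before the strict inequality
    \<open>s < lam * r\<close> may be multiplied by it.\<close>
  have "0 < s * ln (lam * m)"
    using le r lnp by (smt (verit) mult_pos_pos)
  then have "0 < ln (lam * m)"
    using s by (simp add: zero_less_mult_iff)
  then have "s * ln (lam * m) < r * (lam * ln (lam * m))"
    using less by (simp add: algebra_simps)
  also have "\<dots> \<le> r * ln p"
    using lam lnp r by (intro mult_left_mono) auto
  finally show False
    using le by simp
qed

section \<open>Greedy choice of coordinates\<close>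

text \<open>Count the pairs of a prime in \<open>P\<close> and a coordinate in its support in two
  ways: there are at least \<open>lam * F\<close> of them, so some coordinate lies in at least
  \<open>lam * F / n\<close> supports. Adding it lowers \<open>F\<close> by that much, and
  \<open>1 + x \<le> exp x\<close> gives the exponential form.\<close>

lemma greedy_step:
  fixes lam :: real
  assumes P: "finite P" "\<And>p. p \<in> P \<Longrightarrow> prime p" and n: "n > 0"
    and supp: "\<And>p. p \<in> P \<Longrightarrow> lam * rk p I \<le> card (torsion_support p I)"
  obtains i where "i < n" "(\<Sum>p\<in>P. rk p (insert i I)) \<le> exp (- lam / n) * (\<Sum>p\<in>P. rk p I)"
proof -
  define F where "F = (\<Sum>p\<in>P. rk p I)"
  define c where "c i = card {p \<in> P. i \<in> torsion_support p I}" for i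
  have F: "F \<ge> 0"
    unfolding F_def using P rk_nonneg by (intro sum_nonneg) auto
  have "lam * F \<le> (\<Sum>p\<in>P. real (card (torsion_support p I)))"
    unfolding F_def sum_distrib_left using supp by (rule sum_mono)
  also have "(\<Sum>p\<in>P. real (card (torsion_support p I)))
      = (\<Sum>p\<in>P. \<Sum>i<n. if i \<in> torsion_support p I then 1 else 0)"
  proof (rule sum.cong[OF refl])
    fix p assume "p \<in> P"
    have "{..<n} \<inter> torsion_support p I = torsion_support p I"
      using torsion_support_subset by blast
    then show "real (card (torsion_support p I)) = (\<Sum>i<n. if i \<in> torsion_support p I then 1 else 0)"
      by (simp add: sum.If_cases)
  qed
  also have "\<dots> = (\<Sum>i<n. \<Sum>p\<in>P. if i \<in> torsion_support p I then 1 else 0)"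
    by (rule sum.swap)
  also have "\<dots> = (\<Sum>i<n. real (c i))"
    using P by (simp add: c_def sum.If_cases Int_def)
  finally have sum: "lam * F \<le> (\<Sum>i<n. real (c i))" .
  have "\<exists>i<n. lam * F / n \<le> c i"
  proof (rule ccontr)
    assume "\<not> ?thesis"
    then have "(\<Sum>i<n. real (c i)) < (\<Sum>i<n. lam * F / n)"
      using n by (intro sum_strict_mono) auto
    then show False
      using sum n by simp
  qed
  then obtain i where i: "i < n" "lam * F / n \<le> c i"
    by blast
  have "(\<Sum>p\<in>P. rk p (insert i I)) \<le> F - c i"
    using sum_rk_insert_le[OF P] by (simp add: F_def c_def)
  also have "\<dots> \<le> (1 + (- lam / n)) * F"
    using i by (simp add: algebra_simps)
  also have "\<dots> \<le> exp (- lam / n) * F"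
    using F by (intro mult_right_mono exp_ge_add_one_self) auto
  finally show ?thesis
    using that i by (simp add: F_def)
qed

lemma greedy:
  fixes lam :: real and t :: nat
  assumes P: "finite P" "\<And>p. p \<in> P \<Longrightarrow> prime p" and n: "n > 0"
    and supp: "\<And>p I. p \<in> P \<Longrightarrow> lam * rk p I \<le> card (torsion_support p I)"
  shows "\<exists>I\<subseteq>{..<n}. card I \<le> t \<and> (\<Sum>p\<in>P. rk p I) \<le> exp (- lam * t / n) * (\<Sum>p\<in>P. rk p {})"
proof (induction t)
  case 0
  then show ?case by (intro exI[of _ "{}"]) auto
next
  case (Suc t)
  then obtain I where I: "I \<subseteq> {..<n}" "card I \<le> t"
    and le: "(\<Sum>p\<in>P. rk p I) \<le> exp (- lam * t / n) * (\<Sum>p\<in>P. rk p {})"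
    by blast
  obtain i where i: "i < n" "(\<Sum>p\<in>P. rk p (insert i I)) \<le> exp (- lam / n) * (\<Sum>p\<in>P. rk p I)"
    using greedy_step[OF P n supp] by blast
  note i(2)
  also have "exp (- lam / n) * (\<Sum>p\<in>P. rk p I)
      \<le> exp (- lam / n) * (exp (- lam * t / n) * (\<Sum>p\<in>P. rk p {}))"
    using le by (intro mult_left_mono) auto
  also have "\<dots> = exp (- lam * Suc t / n) * (\<Sum>p\<in>P. rk p {})"
  proof -
    have "- lam * Suc t / n = - lam / n + - lam * t / n"
      using n by (simp add: field_simps)
    then show ?thesis
      by (simp only: exp_add mult.assoc)
  qed
  finally have "(\<Sum>p\<in>P. rk p (insert i I)) \<le> exp (- lam * Suc t / n) * (\<Sum>p\<in>P. rk p {})" .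
  \<comment> \<open>The chosen coordinate may already lie in \<open>I\<close>, hence an inequality
    only.\<close>
  moreover have "card (insert i I) \<le> Suc t"
    using I card_insert_le_m1[of "Suc t" I i] by simp
  ultimately show ?case
    using I i by (intro exI[of _ "insert i I"]) auto
qed

text \<open>While some torsion group is nontrivial, a coordinate from its support lowers the total
  rank by at least 1, so the rank pays for each added coordinate. The ranks being real, the
  induction runs on the number of coordinates left.\<close>

lemma complete_to_trivial_torsion:
  assumes P: "finite P" "\<And>p. p \<in> P \<Longrightarrow> prime p" and I: "I \<subseteq> {..<n}"
  shows "\<exists>J\<subseteq>{..<n}. card J \<le> card I + (\<Sum>p\<in>P. rk p I) \<and> (\<forall>p\<in>P. torsion p J = {0})"
  using I
proof (induction "n - card I" arbitrary: I rule: less_induct)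
  case less
  have nonneg: "0 \<le> (\<Sum>p\<in>P. rk p J)" for J
    using P rk_nonneg by (intro sum_nonneg) auto
  have fin: "finite I"
    using less.prems finite_subset by blast
  show ?case
  proof (cases "\<forall>p\<in>P. torsion p I = {0}")
    case True
    then show ?thesis
      using less.prems nonneg[of I] by (intro exI[of _ I]) auto
  next
    case False
    then obtain p x where p: "p \<in> P" "x \<in> torsion p I" "x \<noteq> 0"
      using zero_in_torsion by blast
    then obtain i where xi: "x i \<noteq> 0"
      by (auto simp: fun_eq_iff)
    then have i: "i \<in> torsion_support p I"
      using p by (auto simp: torsion_support_def)
    have iI: "i \<notin> I"
      using xi p by (auto simp: torsion_def)
    have sub: "insert i I \<subseteq> {..<n}"
      using i torsion_support_subset less.prems by blast
    then have "card (insert i I) \<le> n"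
      using card_mono[OF finite_lessThan sub] by simp
    then have "n - card (insert i I) < n - card I"
      using iI fin by simp
    from less.hyps[OF this sub] obtain J where J: "J \<subseteq> {..<n}" "\<forall>p\<in>P. torsion p J = {0}"
      and card: "card J \<le> card (insert i I) + (\<Sum>p\<in>P. rk p (insert i I))"
      by blast
    have "card {p \<in> P. i \<in> torsion_support p I} > 0"
      using P i p by (auto simp: card_gt_0_iff)
    then have "(\<Sum>p\<in>P. rk p (insert i I)) \<le> (\<Sum>p\<in>P. rk p I) - 1"
      using sum_rk_insert_le[OF P, of i I] by linarith
    then have "card J \<le> card I + (\<Sum>p\<in>P. rk p I)"
      using card iI fin by simp
    then show ?thesis
      using J by blast
  qed
qed

end

section \<open>The defect bound with free parameters\<close>

context admissible_lattice
begin

text \<open>The greedy phase looks only at primes above \<open>T\<close>, where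
  \<open>support_ge\<close> guarantees the factor \<open>lam\<close>. The final completion treats
  all primes at once; those up to \<open>T\<close> number at most \<open>T\<close> and have rank at
  most \<open>m\<close> each.\<close>

lemma defect_bound:
  fixes t :: nat and lam :: real
  assumes n: "n > 0" and q: "q > 0"
    and denom: "\<And>x i. x \<in> \<Lambda> \<Longrightarrow> of_nat q * x i \<in> \<int>"
    and card: "\<And>p. p \<in> prime_factors q \<Longrightarrow> card (torsion p {}) \<le> p ^ m"
    and T: "T > 1" and lam: "lam > 0" "lam * ln (lam * m) \<le> ln T"
  shows "defect n \<Lambda> \<le> t + exp (- lam * t / n) * (n * ln n / ln T) + m * T"
proof -
  define P where "P = {p \<in> prime_factors q. T < real p}"
  define P' where "P' = {p \<in> prime_factors q. real p \<le> T}"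
  have P: "finite P" "\<And>p. p \<in> P \<Longrightarrow> prime p" and P': "finite P'" "\<And>p. p \<in> P' \<Longrightarrow> prime p"
    by (auto simp: P_def P'_def)
  have rk_le: "rk p I \<le> m" if "p \<in> prime_factors q" for p I
  proof -
    have p: "prime p" using that by auto
    have "rk p I \<le> rk p {}"
      using p by (intro rk_antimono) auto
    also have "\<dots> \<le> log p (real (p ^ m))"
      unfolding rk_def using card[OF that] card_torsion_pos[of p "{}"] prime_gt_1_nat[OF p]
      by (subst log_le_cancel_iff) (auto simp del: of_nat_power)
    also have "\<dots> = m"
      using prime_gt_1_nat[OF p] by (simp add: log_nat_power)
    finally show ?thesis .
  qed
  have "lam * rk p I \<le> card (torsion_support p I)" if "p \<in> P" for p I
  proof (rule support_ge[OF P(2)[OF that] _ _ _ lam])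
    show "T \<le> p" "0 < T" "rk p I \<le> m"
      using that T rk_le[of p I] by (simp_all add: P_def)
  qed
  from greedy[OF P n this] obtain I where I: "I \<subseteq> {..<n}" "card I \<le> t"
    and sumP: "(\<Sum>p\<in>P. rk p I) \<le> exp (- lam * t / n) * (\<Sum>p\<in>P. rk p {})"
    by blast
  have "(\<Sum>p\<in>P. rk p {}) \<le> n * ln n / ln T"
  proof -
    have "(\<Sum>p\<in>P. rk p {}) * ln T \<le> n * ln n"
    proof (rule sum_rk_le[OF P T _ n])
      show "T < real p" if "p \<in> P" for p
        using that by (simp add: P_def)
    qed
    then show ?thesis
      using T by (simp add: pos_le_divide_eq)
  qed
  then have "exp (- lam * t / n) * (\<Sum>p\<in>P. rk p {}) \<le> exp (- lam * t / n) * (n * ln n / ln T)"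
    by (rule mult_left_mono) simp
  with sumP have large: "(\<Sum>p\<in>P. rk p I) \<le> exp (- lam * t / n) * (n * ln n / ln T)"
    by linarith
  have "P' \<subseteq> {1..nat \<lfloor>T\<rfloor>}"
    using P'(2) by (auto simp: P'_def le_nat_floor Suc_le_eq prime_gt_0_nat)
  then have "card P' \<le> nat \<lfloor>T\<rfloor>"
    using card_mono[of "{1..nat \<lfloor>T\<rfloor>}" P'] by simp
  then have "card P' \<le> T"
    using T by linarith
  moreover have "(\<Sum>p\<in>P'. rk p I) \<le> card P' * real m"
    using rk_le by (intro sum_bounded_above) (auto simp: P'_def)
  ultimately have small: "(\<Sum>p\<in>P'. rk p I) \<le> m * T"
    by (smt (verit) mult.commute mult_left_mono of_nat_0_le_iff)
  have split: "prime_factors q = P \<union> P'" "P \<inter> P' = {}"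
    by (auto simp: P_def P'_def)
  have "finite (prime_factors q)" "\<And>p. p \<in> prime_factors q \<Longrightarrow> prime p"
    by auto
  from complete_to_trivial_torsion[OF this I(1)]
  obtain J where J: "J \<subseteq> {..<n}" "\<forall>p\<in>prime_factors q. torsion p J = {0}"
    and cardJ: "card J \<le> card I + (\<Sum>p\<in>prime_factors q. rk p I)"
    by blast
  have "(\<Sum>p\<in>prime_factors q. rk p I) = (\<Sum>p\<in>P. rk p I) + (\<Sum>p\<in>P'. rk p I)"
    unfolding split(1) using P(1) P'(1) split(2) by (rule sum.union_disjoint)
  moreover have "defect n \<Lambda> \<le> card J"
    using J denom by (intro defect_le_if_torsion_trivial[OF _ q]) auto
  ultimately show ?thesis
    using large small cardJ I(2) by linarith
qed

end

section \<open>Lattices generated by \<open>m\<close> vectors over the integer lattice\<close>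

lemma span_int_lattice_Un:
  fixes m :: nat
  assumes "x \<in> zmod.span (int_lattice n \<union> a ` {..<m})"
  shows "\<exists>c. x - (\<Sum>j<m. zscale (c j) (a j)) \<in> int_lattice n"
proof -
  define W where "W = {x. \<exists>c. x - (\<Sum>j<m. zscale (c j) (a j)) \<in> int_lattice n}"
  have memW: "x \<in> W" if "x - (\<Sum>j<m. zscale (c j) (a j)) \<in> int_lattice n" for x c
    unfolding W_def using that by (intro CollectI exI[of _ c])
  note sub = subspace_int_lattice[of n]
  have "zmod.subspace W"
  proof (rule zmod.subspaceI)
    have "(0 :: nat \<Rightarrow> real) - (\<Sum>j<m. zscale 0 (a j)) \<in> int_lattice n"
      using zmod.subspace_0[OF sub] by simp
    then show "0 \<in> W"
      by (rule memW)
  next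
    fix x y assume "x \<in> W" "y \<in> W"
    then obtain c d where "x - (\<Sum>j<m. zscale (c j) (a j)) \<in> int_lattice n"
      "y - (\<Sum>j<m. zscale (d j) (a j)) \<in> int_lattice n"
      unfolding W_def by blast
    then have "(x - (\<Sum>j<m. zscale (c j) (a j))) + (y - (\<Sum>j<m. zscale (d j) (a j))) \<in> int_lattice n"
      by (rule zmod.subspace_add[OF sub])
    also have "(x - (\<Sum>j<m. zscale (c j) (a j))) + (y - (\<Sum>j<m. zscale (d j) (a j)))
        = (x + y) - (\<Sum>j<m. zscale (c j + d j) (a j))"
      by (simp add: zmod.scale_left_distrib sum.distrib)
    finally show "x + y \<in> W"
      by (rule memW)
  next
    fix k x assume "x \<in> W"
    then obtain c where "x - (\<Sum>j<m. zscale (c j) (a j)) \<in> int_lattice n"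
      unfolding W_def by blast
    then have "zscale k (x - (\<Sum>j<m. zscale (c j) (a j))) \<in> int_lattice n"
      by (rule zmod.subspace_scale[OF sub])
    also have "zscale k (x - (\<Sum>j<m. zscale (c j) (a j)))
        = zscale k x - (\<Sum>j<m. zscale (k * c j) (a j))"
      by (simp add: zmod.scale_right_diff_distrib zmod.scale_sum_right)
    finally show "zscale k x \<in> W"
      by (rule memW)
  qed
  moreover have "int_lattice n \<union> a ` {..<m} \<subseteq> W"
  proof -
    have "x \<in> W" if "x \<in> int_lattice n" for x
    proof -
      have "x - (\<Sum>j<m. zscale 0 (a j)) \<in> int_lattice n"
        using that by simp
      then show ?thesis
        by (rule memW)
    qed
    moreover have "a i \<in> W" if "i < m" for i
    proof -
      have "(\<Sum>j<m. zscale (if j = i then 1 else 0) (a j)) = (\<Sum>j<m. if j = i then a j else 0)"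
        by (intro sum.cong) auto
      also have "\<dots> = a i"
        using that by simp
      finally have "a i - (\<Sum>j<m. zscale (if j = i then 1 else 0) (a j)) \<in> int_lattice n"
        using zmod.subspace_0[OF sub] by simp
      then show ?thesis
        by (rule memW)
    qed
    ultimately show ?thesis by auto
  qed
  ultimately have "zmod.span (int_lattice n \<union> a ` {..<m}) \<subseteq> W"
    by (rule zmod.span_minimal[rotated])
  then show ?thesis
    using assms unfolding W_def by blast
qed

text \<open>As \<open>q\<close> is square-free, \<open>p\<close> is coprime to \<open>q / p\<close>, so modulo the integer lattice the
  \<open>p\<close>-torsion is generated by the \<open>m\<close> vectors \<open>(q / p) a\<^sub>j\<close>.\<close>

lemma card_torsion_le_generators:
  assumes lat: "lattice_above_int n \<Lambda>" and \<Lambda>: "\<Lambda> = zmod.span (int_lattice n \<union> a ` {..<m})"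
    and q: "squarefree q" and a: "\<And>j i. j < m \<Longrightarrow> of_nat q * a j i \<in> \<int>"
    and p: "p \<in> prime_factors q"
  shows "card (lattice_above_int.torsion n \<Lambda> p {}) \<le> p ^ m"
proof -
  interpret lattice_above_int n \<Lambda>
    by (rule lat)
  have prime: "prime p" and "p dvd q"
    using p by auto
  then obtain q' where q': "q = p * q'"
    by (auto elim: dvdE)
  have "\<not> p dvd q'"
  proof
    assume "p dvd q'"
    then have "p\<^sup>2 dvd q"
      unfolding q' power2_eq_square by (intro mult_dvd_mono) auto
    then show False
      using squarefreeD[OF q, of p] prime by auto
  qed
  then have "coprime p q'"
    using prime by (simp add: prime_imp_coprime)
  then obtain u v where uv: "u * int p + v * int q' = 1"
    using bezout_int[of "int p" "int q'"] by auto
  define f where "f = (\<lambda>c :: nat \<Rightarrow> nat. frac_vec (\<Sum>j<m. zscale (int (c j) * int q') (a j)))"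
  have "torsion p {} \<subseteq> f ` PiE {..<m} (\<lambda>_. {..<p})"
  proof
    fix x assume x: "x \<in> torsion p {}"
    then have "x \<in> \<Lambda>"
      by (simp add: torsion_def)
    then obtain c where c: "x - (\<Sum>j<m. zscale (c j) (a j)) \<in> int_lattice n"
      using span_int_lattice_Un unfolding \<Lambda> by blast
    \<comment> \<open>Modulo integers \<open>x = v q' x\<close> by Bezout, since \<open>p x\<close>
      is integral; inserting the combination for \<open>x\<close> gives \<open>q' a j\<close> the
      coefficient \<open>v * c j\<close>. As \<open>p q' a j = q a j\<close> is integral, this
      coefficient matters only modulo \<open>p\<close>.\<close>
    define e where "e = restrict (\<lambda>j. nat ((v * c j) mod int p)) {..<m}"
    have p0: "int p > 0"
      using prime prime_gt_0_nat by simp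
    have e: "e \<in> PiE {..<m} (\<lambda>_. {..<p})"
      using p0 by (auto simp: e_def nat_less_iff)
    have int: "x i - (\<Sum>j<m. of_nat (e j) * of_nat q' * a j i) \<in> \<int>" for i
    proof -
      have ej: "of_int v * of_int (c j) * of_nat q' * a j i - of_nat (e j) * of_nat q' * a j i \<in> \<int>"
        if "j < m" for j
      proof -
        have "(v * c j) = (v * c j) div int p * int p + int (e j)"
          using that p0 by (simp add: e_def)
        then have "of_int v * of_int (c j) = of_int ((v * c j) div int p) * of_nat p + (of_nat (e j) :: real)"
          by (metis of_int_add of_int_mult of_int_of_nat_eq)
        then have "of_int v * of_int (c j) * of_nat q' * a j i - of_nat (e j) * of_nat q' * a j i
            = of_int ((v * c j) div int p) * (of_nat q * a j i)"
          by (simp add: q' algebra_simps)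
        then show ?thesis
          using a[OF that, of i] by simp
      qed
      have ci: "x i - (\<Sum>j<m. of_int (c j) * a j i) \<in> \<int>"
        using c by (auto simp: int_lattice_iff sum_apply_fun zscale_apply)
      have "of_int u * of_nat p + of_int v * of_nat q' = (1 :: real)"
        using uv by (metis of_int_1 of_int_add of_int_mult of_int_of_nat_eq)
      then have "x i = (of_int u * of_nat p + of_int v * of_nat q') * x i"
        by simp
      then have "x i - (\<Sum>j<m. of_nat (e j) * of_nat q' * a j i)
          = of_int u * (of_nat p * x i)
            + of_int v * of_nat q' * (x i - (\<Sum>j<m. of_int (c j) * a j i))
            + (\<Sum>j<m. of_int v * of_int (c j) * of_nat q' * a j i - of_nat (e j) * of_nat q' * a j i)"
        by (simp add: sum_subtractf sum_distrib_left algebra_simps)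
      also have "\<dots> \<in> \<int>"
        using ej by (intro Ints_add Ints_sum Ints_mult[OF Ints_of_int torsion_int[OF x]]
          Ints_mult[OF _ ci]) auto
      finally show ?thesis .
    qed
    have "x = f e"
    proof
      fix i
      define s where "s = (\<Sum>j<m. of_nat (e j) * of_nat q' * a j i)"
      have "0 \<le> x i" "x i < 1"
        using x by (auto simp: torsion_def)
      then have "frac s = x i"
        using int[of i] unfolding s_def[symmetric] frac_unique_iff
        by (metis Ints_minus minus_diff_eq)
      then show "x i = f e i"
        by (simp add: f_def frac_vec_def sum_apply_fun zscale_apply s_def)
    qed
    then show "x \<in> f ` PiE {..<m} (\<lambda>_. {..<p})"
      using e by blast
  qed
  then have "card (torsion p {}) \<le> card (PiE {..<m} (\<lambda>_. {..<p}))"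
    by (rule surj_card_le[rotated]) (auto intro: finite_PiE)
  then show ?thesis
    by (simp add: card_PiE)
qed

lemma squarefree_latticesE:
  assumes "\<Lambda> \<in> squarefree_lattices n m"
  obtains q where "q > 0" "lattice_above_int n \<Lambda>" "\<And>x i. x \<in> \<Lambda> \<Longrightarrow> of_nat q * x i \<in> \<int>"
    "\<And>p. p \<in> prime_factors q \<Longrightarrow> card (lattice_above_int.torsion n \<Lambda> p {}) \<le> p ^ m"
proof -
  obtain a q where \<Lambda>: "\<Lambda> = zmod.span (int_lattice n \<union> a ` {..<m})"
    and a: "\<forall>j<m. a j \<in> rat_space n" and q: "q > 0" "squarefree q"
    and qa: "\<forall>j<m. zscale (int q) (a j) \<in> int_lattice n"
    using assms unfolding squarefree_lattices_def by blast
  have "int_lattice n \<union> a ` {..<m} \<subseteq> real_space n"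
    using a by (auto simp: int_lattice_def rat_space_def)
  then have "\<Lambda> \<subseteq> real_space n"
    unfolding \<Lambda> by (rule zmod.span_minimal[OF _ subspace_real_space])
  moreover have "zmod.subspace \<Lambda>" "int_lattice n \<subseteq> \<Lambda>"
    unfolding \<Lambda> using zmod.span_superset[of "int_lattice n \<union> a ` {..<m}"]
    by (auto intro: zmod.subspace_span)
  ultimately have "lattice_above_int n \<Lambda>"
    by unfold_locales
  moreover have "of_nat q * x i \<in> \<int>" if "x \<in> \<Lambda>" for x i
  proof -
    have "zmod.subspace {x. \<forall>i. of_nat q * x i \<in> \<int>}"
      by (rule zmod.subspaceI) (auto simp: zscale_apply distrib_left mult.left_commute[of "of_nat q"])
    moreover have "int_lattice n \<union> a ` {..<m} \<subseteq> {x. \<forall>i. of_nat q * x i \<in> \<int>}"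
      using qa by (auto simp: int_lattice_iff zscale_apply)
    ultimately show ?thesis
      using that zmod.span_minimal unfolding \<Lambda> by blast
  qed
  moreover have "of_nat q * a j i \<in> \<int>" if "j < m" for j i
    using qa that by (auto simp: int_lattice_iff zscale_apply)
  ultimately show ?thesis
    using that card_torsion_le_generators[OF _ \<Lambda> q(2)] q(1) by blast
qed

section \<open>Existence of the maximum\<close>

lemma int_lattice_in_squarefree_lattices: "int_lattice n \<in> squarefree_lattices n m"
proof -
  have "zmod.span (int_lattice n \<union> (\<lambda>_. 0) ` {..<m}) = int_lattice n"
    using subspace_int_lattice[of n] zmod.subspace_0[OF subspace_int_lattice[of n]]
    by (simp add: Un_absorb2 image_subset_iff zmod.span_eq_iff)
  moreover have "(0 :: nat \<Rightarrow> real) \<in> rat_space n" "zscale (int 1) 0 \<in> int_lattice n"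
    by (auto simp: rat_space_def real_space_def int_lattice_iff zscale_apply)
  ultimately show ?thesis
    unfolding squarefree_lattices_def
    by (intro CollectI exI[of _ "\<lambda>_. 0"] conjI exI[of _ 1]) auto
qed

text \<open>A nonzero integer vector has a coordinate of absolute value at least 1, which exhausts
  the norm. Thus the integer lattice witnesses that the maximum is over a nonempty set.\<close>

lemma admissible_int_lattice: "admissible n (int_lattice n)"
proof -
  have unit: "(\<Sum>j<n. \<bar>unit_vector i j\<bar>) = 1" if "i < n" for i
    using that by (simp add: unit_vector_def if_distrib cong: if_cong)
  have "x \<in> {0} \<union> std_basis n \<union> uminus ` std_basis n"
    if x: "x \<in> int_lattice n" "(\<Sum>i<n. \<bar>x i\<bar>) \<le> 1" "x \<noteq> 0" for x
  proof -
    obtain i where xi: "x i \<noteq> 0"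
      using x by (auto simp: fun_eq_iff)
    then have i: "i < n"
      using x by (auto simp: int_lattice_iff not_less[symmetric])
    have "1 \<le> \<bar>x i\<bar>"
      using x xi Ints_nonzero_abs_ge1 by (auto simp: int_lattice_iff)
    moreover have "(\<Sum>j<n. \<bar>x j\<bar>) = \<bar>x i\<bar> + (\<Sum>j\<in>{..<n} - {i}. \<bar>x j\<bar>)"
      using i by (simp add: sum.remove)
    moreover have nonneg: "(\<Sum>j\<in>{..<n} - {i}. \<bar>x j\<bar>) \<ge> 0"
      by (simp add: sum_nonneg)
    ultimately have one: "\<bar>x i\<bar> = 1" and "(\<Sum>j\<in>{..<n} - {i}. \<bar>x j\<bar>) = 0"
      using x(2) by linarith+
    then have "x j = 0" if "j \<noteq> i" for j
      using that x(1) by (cases "j < n") (auto simp: sum_nonneg_eq_0_iff int_lattice_iff)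
    then have "x = unit_vector i \<or> x = - unit_vector i"
      using one by (auto simp: fun_eq_iff unit_vector_def abs_if split: if_splits)
    then show ?thesis
      using i by (auto simp: std_basis_def)
  qed
  moreover have "unit_vector i \<in> octahedron n" "- unit_vector i \<in> octahedron n" if "i < n" for i
    using unit[OF that] that by (auto simp: octahedron_def real_space_def unit_vector_def)
  moreover have "- unit_vector i \<in> int_lattice n" if "i < n" for i
    using zmod.subspace_neg[OF subspace_int_lattice unit_vector_in_int_lattice[OF that]] .
  moreover have "0 \<in> octahedron n" "0 \<in> int_lattice n"
    by (auto simp: octahedron_def real_space_def int_lattice_iff)
  ultimately show ?thesis
    unfolding admissible_def
    by (auto simp: octahedron_def std_basis_def unit_vector_in_int_lattice)
qed

text \<open>\<open>Max\<close> is meaningful only on a finite nonempty set: finiteness comes from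
  the assumed bound \<open>B\<close>, nonemptiness from the integer lattice.\<close>

lemma max_defect_le:
  assumes "\<And>\<Lambda>. \<Lambda> \<in> squarefree_lattices n m \<Longrightarrow> admissible n \<Lambda> \<Longrightarrow> real (defect n \<Lambda>) \<le> B"
  shows "real (max_defect n m) \<le> B"
proof -
  define D where "D = {defect n \<Lambda> | \<Lambda>. \<Lambda> \<in> squarefree_lattices n m \<and> admissible n \<Lambda>}"
  have "d \<le> nat \<lfloor>B\<rfloor>" if "d \<in> D" for d
    using that assms by (auto simp: D_def le_nat_floor)
  then have "D \<subseteq> {..nat \<lfloor>B\<rfloor>}"
    by auto
  then have "finite D"
    using finite_subset by blast
  moreover have "D \<noteq> {}"
    unfolding D_def using int_lattice_in_squarefree_lattices admissible_int_lattice by blast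
  ultimately have "Max D \<in> D"
    by (rule Max_in)
  then show ?thesis
    using assms unfolding max_defect_def D_def[symmetric] by (auto simp: D_def)
qed

section \<open>Numerical estimates for logarithms\<close>

text \<open>\<open>exp (- 1 / 6) \<ge> 5 / 6\<close> yields e <= (6/5)^6 < 3. The result makes
  \<open>ln (ln 3)\<close> positive.\<close>

lemma ln_3_gt_1: "1 < ln (3 :: real)"
proof -
  have "5 / 6 \<le> exp (- (1 / 6) :: real)"
    using exp_ge_add_one_self[of "- (1 / 6) :: real"] by simp
  then have "exp (1 / 6 :: real) \<le> 6 / 5"
    by (simp add: exp_minus field_simps)
  then have "exp (1 / 6 :: real) ^ 6 \<le> (6 / 5) ^ 6"
    by (intro power_mono) auto
  also have "\<dots> < 3"
    by (simp add: power_divide)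
  finally have "exp 1 < (3 :: real)"
    by (simp flip: exp_of_nat_mult)
  then have "ln (exp 1) < ln (3 :: real)"
    by (subst ln_less_cancel_iff) auto
  then show ?thesis by simp
qed

text \<open>Since \<open>n \<ge> m + 2\<close>, Bernoulli's inequality gives (n/m)^m >= (1 + 2/m)^m
  >= 3. Exceeding e, this keeps the iterated logarithm away from 0.\<close>

lemma ln_3_le_mult_ln:
  assumes "0 < m" "m + 1 < (n :: nat)"
  shows "ln 3 \<le> m * ln (n / m)"
proof -
  have "3 = 1 + real m * (2 / m)"
    using assms by simp
  also have "\<dots> \<le> (1 + 2 / real m) ^ m"
    by (rule Bernoulli_inequality) (simp add: order_trans[of _ 0])
  also have "\<dots> \<le> (n / m) ^ m"
  proof (rule power_mono)
    have "1 + 2 / real m = (m + 2) / m"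
      using assms by (simp add: field_simps)
    also have "\<dots> \<le> n / m"
      using assms by (intro divide_right_mono) auto
    finally show "1 + 2 / real m \<le> n / m" .
  qed auto
  finally have "ln 3 \<le> ln ((n / real m) ^ m)"
    by (subst ln_le_cancel_iff) auto
  then show ?thesis
    using assms by (simp add: ln_realpow)
qed

section \<open>Choice of the parameters for a large ratio\<close>

text \<open>The assumption \<open>ln m \<le> ln (n / m)\<close> gives
  \<open>ln n \<le> 2 * ln A\<close>, so the initial total rank is at most \<open>4 * n\<close>. The
  greedy phase shrinks it by the factor \<open>1 / L\<close>, and all three terms of
  \<open>defect_bound\<close> become comparable with the claim.\<close>

lemma defect_le_large_ratio:
  assumes m: "0 < m" "m < n" and \<Lambda>: "\<Lambda> \<in> squarefree_lattices n m" "admissible n \<Lambda>"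
    and ratio: "3 \<le> ln (n / m)" "ln m \<le> ln (n / m)"
  defines "L \<equiv> m * ln (n / m)"
  shows "real (defect n \<Lambda>) \<le> 9 * real n * (ln L)\<^sup>2 / ln (n / m)"
proof -
  obtain q where q: "q > 0" and lat: "lattice_above_int n \<Lambda>"
    and denom: "\<And>x i. x \<in> \<Lambda> \<Longrightarrow> of_nat q * x i \<in> \<int>"
    and card: "\<And>p. p \<in> prime_factors q \<Longrightarrow> card (lattice_above_int.torsion n \<Lambda> p {}) \<le> p ^ m"
    using squarefree_latticesE[OF \<Lambda>(1)] by blast
  interpret admissible_lattice n \<Lambda>
    using lat \<Lambda>(2) by (simp add: admissible_lattice_def admissible_lattice_axioms_def)
  define A where "A = real n / m"
  define T where "T = sqrt A"
  \<comment> \<open>\<open>lam\<close> satisfies \<open>lam * ln L = ln T\<close>, and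
    \<open>X\<close> satisfies \<open>lam * X / n = ln L\<close>, so that \<open>t \<ge> X\<close>
    greedy steps leave at most a fraction \<open>1 / L\<close> of the rank.\<close>
  define lam where "lam = ln A / (2 * ln L)"
  define X where "X = 2 * real n * (ln L)\<^sup>2 / ln A"
  define t where "t = nat \<lceil>X\<rceil>"
  have n: "n > 0" and A: "A > 1" and lnA: "ln A \<ge> 3"
    using m ratio by (auto simp: A_def)
  have L: "L \<ge> ln A"
    using m lnA by (simp add: L_def A_def)
  \<comment> \<open>Here the constant 3 enters: e <= 3 <= \<open>L\<close>.\<close>
  then have "ln (exp 1) \<le> ln L"
    using exp_le lnA by (subst ln_le_cancel_iff) auto
  then have lnL: "ln L \<ge> 1"
    by simp
  have T: "T > 1" and lnT: "ln T = ln A / 2"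
    using A by (simp_all add: T_def ln_sqrt)
  have lam0: "lam > 0"
    using lnA lnL by (simp add: lam_def)
  have "lam * m = L / (2 * ln L)"
    by (simp add: lam_def L_def A_def)
  also have "\<dots> \<le> L"
    using L lnA lnL by (simp add: pos_divide_le_eq)
  finally have "ln (lam * m) \<le> ln L"
    using lam0 m L lnA by (subst ln_le_cancel_iff) auto
  then have "lam * ln (lam * m) \<le> lam * ln L"
    using lam0 by (intro mult_left_mono) auto
  also have "\<dots> = ln T"
    using lnL by (simp add: lam_def lnT)
  finally have lam: "lam * ln (lam * m) \<le> ln T" .
  have X0: "X \<ge> 0"
    using lnA by (simp add: X_def)
  have t: "X \<le> t" "t \<le> X + 1"
    using X0 unfolding t_def by linarith+
  have "exp (- lam * t / n) \<le> 1 / ln A"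
  proof -
    have "lam * X / n = ln L"
      using n lnA lnL by (simp add: lam_def X_def power2_eq_square)
    moreover have "lam * X / n \<le> lam * t / n"
      using t lam0 by (intro divide_right_mono mult_left_mono) auto
    ultimately have "exp (- lam * t / n) \<le> exp (- ln L)"
      by simp
    also have "\<dots> = 1 / L"
      using L lnA by (simp add: exp_minus inverse_eq_divide)
    also have "\<dots> \<le> 1 / ln A"
      using L lnA by (intro divide_left_mono) auto
    finally show ?thesis .
  qed
  moreover have "n * ln n / ln T \<le> 4 * real n"
  proof -
    have "real n = m * A"
      using m by (simp add: A_def)
    then have "ln n = ln m + ln A"
      using m A by (simp add: ln_mult)
    also have "\<dots> \<le> 2 * ln A"
      using ratio by (simp add: A_def)
    finally have "n * ln n \<le> n * (2 * ln A)"
      by (intro mult_left_mono) auto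
    then show ?thesis
      using lnA by (simp add: lnT pos_divide_le_eq)
  qed
  moreover have "0 \<le> n * ln n / ln T"
    using n lnA by (simp add: lnT)
  ultimately have E1: "exp (- lam * t / n) * (n * ln n / ln T) \<le> 1 / ln A * (4 * real n)"
    using lnA by (intro mult_mono) auto
  \<comment> \<open>\<open>m * T * ln A = 2 * m * T * ln T\<close>, which is at most 2 m T^2 = 2 m A
    = 2 n.\<close>
  have E2: "m * T \<le> 2 * real n / ln A"
  proof -
    have "ln T \<le> T"
      using ln_le_minus_one[of T] T by linarith
    then have "m * T * ln A \<le> m * T * (2 * T)"
      using lnT T by (intro mult_left_mono) auto
    also have "\<dots> = 2 * (m * A)"
      using A by (simp add: T_def)
    also have "\<dots> = 2 * real n"
      using m by (simp add: A_def)
    finally show ?thesis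
      using lnA by (simp add: pos_le_divide_eq)
  qed
  have E3: "1 \<le> n / ln A"
  proof -
    have "A \<le> n"
      using m by (simp add: A_def field_simps)
    moreover have "ln A \<le> A"
      using ln_le_minus_one[of A] A by linarith
    ultimately show ?thesis
      using lnA by (simp add: pos_le_divide_eq)
  qed
  have E4: "n / ln A \<le> n * (ln L)\<^sup>2 / ln A"
    using lnL lnA by (intro divide_right_mono) (auto simp: mult_le_cancel_left1)
  have "real (defect n \<Lambda>) \<le> t + exp (- lam * t / n) * (n * ln n / ln T) + m * T"
    using denom card by (intro defect_bound[OF n q _ _ T lam0 lam])
  also have "\<dots> \<le> 9 * (n * (ln L)\<^sup>2 / ln A)"
  proof -
    \<comment> \<open>With \<open>y = n / ln A\<close> and \<open>z = y * (ln L)\<^sup>2\<close>,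
      the ceiling in \<open>t\<close> costs \<open>1 \<le> y\<close>, and the sum is at most 2 z +
      (1 + 4 + 2) y <= 9 z.\<close>
    have *: "a + b + c \<le> 9 * z" if "a \<le> 2 * z + 1" "b \<le> 4 * y" "c \<le> 2 * y" "1 \<le> y" "y \<le> z"
      for a b c y z :: real
      using that by linarith
    show ?thesis
    proof (rule *[OF _ _ _ E3 E4])
      show "t \<le> 2 * (n * (ln L)\<^sup>2 / ln A) + 1"
        using t(2) by (simp add: X_def)
    qed (use E1 E2 in simp_all)
  qed
  finally show ?thesis
    by (simp add: A_def)
qed

section \<open>One constant for all ratios\<close>

lemma defect_le_dimension_squarefree:
  assumes "\<Lambda> \<in> squarefree_lattices n m"
  shows "defect n \<Lambda> \<le> n"
  using squarefree_latticesE[OF assms] lattice_above_int.defect_le_dimension by metis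

(* For m < n one has (n/m)^m > e iff m + 1 < n.  For m + 1 = n the iterated logarithm is
   negative and tends to 0, and the bound with its square is false (Hamming codes), so the
   factor is replaced by 1 in that case. *)
theorem theorem2:
  shows "\<exists>C::real. C > 0 \<and>
    (\<forall>m n :: nat. 0 < m \<longrightarrow> m < n \<longrightarrow>
       real (max_defect n m) \<le>
         C * (real n * ln (real m + 1) / ln (real n / real m)) *
         (if m + 1 < n then (ln (ln ((real n / real m) ^ m)))\<^sup>2 else 1))"
proof -
  \<comment> \<open>A positive lower bound for the squared factor when \<open>m + 1 < n\<close>, so
    that the trivial bound \<open>n\<close> can be absorbed there.\<close>
  define c0 :: real where "c0 = (ln (ln 3))\<^sup>2"
  have c0: "c0 > 0"
    using ln_3_gt_1 by (simp add: c0_def)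
  \<comment> \<open>One summand per case: 1 for \<open>n = m + 1\<close>, \<open>9 / ln 2\<close>
    for large ratios, where inserting \<open>ln (m + 1)\<close> costs \<open>1 / ln 2\<close>, and
    the last for small ratios.\<close>
  define C :: real where "C = 1 + 9 / ln 2 + 3 / (ln 2 * c0)"
  have C: "C \<ge> 1" "C \<ge> 9 / ln 2" "C \<ge> 3 / (ln 2 * c0)"
    using c0 by (simp_all add: C_def)
  have "real (max_defect n m) \<le> C * (n * ln (m + 1) / ln (n / m)) *
      (if m + 1 < n then (ln (ln ((n / m) ^ m)))\<^sup>2 else 1)" if m: "0 < m" "m < n" for m n :: nat
  proof (rule max_defect_le)
    fix \<Lambda> assume \<Lambda>: "\<Lambda> \<in> squarefree_lattices n m" "admissible n \<Lambda>"
    have triv: "real (defect n \<Lambda>) \<le> n"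
      using defect_le_dimension_squarefree[OF \<Lambda>(1)] by simp
    define L where "L = m * ln (n / m)"
    have A: "n / m > (1 :: real)"
      using m by simp
    then have lnA: "ln (n / m) > 0"
      by simp
    have lnm: "ln 2 \<le> ln (real m + 1)"
      using m by (subst ln_le_cancel_iff) auto
    show "real (defect n \<Lambda>) \<le> C * (n * ln (m + 1) / ln (n / m)) *
      (if m + 1 < n then (ln (ln ((n / m) ^ m)))\<^sup>2 else 1)"
    proof (cases "m + 1 < n")
      case False
      then have "n = m + 1"
        using m by simp
      moreover have "real n / m \<le> real n / 1"
        using m by (intro divide_left_mono) auto
      ultimately have "ln (n / m) \<le> ln (real m + 1)"
        using m by (subst ln_le_cancel_iff) auto
      then have "1 * real n \<le> C * (n * ln (real m + 1) / ln (n / m))"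
        using C(1) lnA by (intro mult_mono) (auto simp: pos_le_divide_eq intro!: mult_left_mono)
      then show ?thesis
        using False triv by (simp add: add.commute)
    next
      case True
      have L3: "ln 3 \<le> L"
        using ln_3_le_mult_ln[OF m(1) True] by (simp add: L_def)
      have lnL: "ln ((n / m) ^ m) = L"
        using m by (simp add: L_def ln_realpow)
      have "ln (ln 3) \<le> ln L"
        using L3 ln_3_gt_1 by (subst ln_le_cancel_iff) auto
      then have c0L: "c0 \<le> (ln L)\<^sup>2"
        unfolding c0_def using ln_3_gt_1 by (intro power_mono) auto
      have "real (defect n \<Lambda>) \<le> C * (n * ln (real m + 1) / ln (n / m)) * (ln L)\<^sup>2"
      \<comment> \<open>The threshold is set so that its failure yields both ratio conditions of
        \<open>defect_le_large_ratio\<close>: \<open>3 \<le> ln (n / m)\<close> because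
        \<open>ln (m + 1) \<ge> ln 2\<close>, and \<open>ln m \<le> ln (n / m)\<close> because
        \<open>3 / ln 2 \<ge> 1\<close>. Below it the trivial bound is enough.\<close>
      proof (cases "ln (n / m) * ln 2 \<le> 3 * ln (real m + 1)")
        case True
        have "real n = 3 / (ln 2 * c0) * (n * (ln 2 / 3)) * c0"
          using c0 by simp
        also have "\<dots> \<le> C * (n * (ln (real m + 1) / ln (n / m))) * (ln L)\<^sup>2"
          using C True lnA lnm c0 c0L
          by (intro mult_mono) (auto simp: field_simps)
        finally show ?thesis
          using triv by simp
      next
        case False
        then have large: "3 * ln (real m + 1) / ln 2 \<le> ln (n / m)"
          by (simp add: pos_divide_le_eq)
        have "3 \<le> 3 * ln (real m + 1) / ln 2"
          using lnm by (simp add: pos_le_divide_eq)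
        moreover have "ln m \<le> ln (n / m)"
        proof -
          have "ln m \<le> ln (real m + 1)"
            using m by (subst ln_le_cancel_iff) auto
          also have "\<dots> \<le> 3 * ln (real m + 1) / ln 2"
            using lnm ln_2_less_1 by (simp add: pos_le_divide_eq)
          finally show ?thesis
            using large by linarith
        qed
        ultimately have "real (defect n \<Lambda>) \<le> 9 * real n * (ln L)\<^sup>2 / ln (n / m)"
          unfolding L_def using large
          by (intro defect_le_large_ratio[OF m \<Lambda>]) linarith+
        also have "\<dots> = 9 / ln 2 * (n * ln 2 / ln (n / m)) * (ln L)\<^sup>2"
          by simp
        also have "\<dots> \<le> C * (n * ln (real m + 1) / ln (n / m)) * (ln L)\<^sup>2"
          using C lnm lnA by (intro mult_mono mult_left_mono divide_right_mono) auto
        finally show ?thesis .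
      qed
      then show ?thesis
        using True lnL by (simp add: add.commute)
    qed
  qed
  then show ?thesis
    using C(1) by (intro exI[of _ C]) (auto simp: add.commute)
qed

end
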